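(* Let $F:\mathcal{E}\to\mathcal{B}$ be a Kumjian-Pask fibration. For every morphism $\mu:Y\to X$ in $\mathcal{E}$ there exist bijections $\mathrm{ind}_\mu:Z(Y)\to Z(\mu)$ and $\mathrm{res}_\mu:Z(\mu)\to Z(Y)$ satisfying the following properties: (1) $\mathrm{ind}_\mu(x)(F(\mu)a)=\mu\,x(a)$ for any $x\in Z(s(\mu))$ and any $a\in F(s(\mu))\mathcal{B}$; (2) $\mathrm{ind}_\mu\circ\mathrm{res}_\mu=\mathrm{Id}_{Z(\mu)}$ and $\mathrm{res}_\mu\circ\mathrm{ind}_\mu=\mathrm{Id}_{Z(s(\mu))}$; (3) for $X$ an object of $\mathcal{E}$, $\mathrm{ind}_{\mathrm{Id}_X}=\mathrm{res}_{\mathrm{Id}_X}=\mathrm{Id}_{Z(X)}$; (4) for $\mu,\nu\in\mathcal{E}$ with $s(\mu)=r(\nu)$, $\mathrm{res}_\mu(Z(\mu\nu))=Z(\nu)$ and $\mathrm{ind}_\mu(Z(\nu))=Z(\mu\nu)$; (5) for $\mu,\nu\in\mathcal{E}$ with $s(\mu)=r(\nu)$, the domain of $\mathrm{res}_\nu\circ\mathrm{res}_\mu$ is $Z(\mu\nu)$ and $\mathrm{res}_\nu\circ\mathrm{res}_\mu=\mathrm{res}_{\mu\nu}$; (6) for $\mu,\nu\in\mathcal{E}$ with $s(\mu)=r(\nu)$, the domain of $\mathrm{ind}_\mu\circ\mathrm{ind}_\nu$ is $Z(s(\nu))$ and $\mathrm{ind}_\mu\circ\mathrm{ind}_\nu=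\mathrm{ind}_{\mu\nu}$.
   Context: All categories are small; a category is often identified with its set of morphisms. Composition is written anti-diagrammatically: for $\beta:C\to B$ and $\alpha:B\to A$ the composite is $\alpha\beta$; $r(\alpha)$ is the codomain and $s(\alpha)$ the domain of $\alpha$. For an object $X$ of $\mathcal{C}$, $X\mathcal{C}$ is the set of morphisms with codomain $X$. A functor $F:\mathcal{E}\to\mathcal{B}$ is a discrete Conduché fibration if for every morphism $\phi$ of $\mathcal{E}$ and every factorization $F(\phi)=\rho\lambda$ in $\mathcal{B}$ there is a unique factorization $\phi=\tilde\rho\tilde\lambda$ in $\mathcal{E}$ with $F(\tilde\rho)=\rho$, $F(\tilde\lambda)=\lambda$. A category is right Ore if for every cospan $m,n$ (morphisms with common codomain) there are $p,q$ with $mp=nq$. It is strongly right Ore if it is right Ore and, for every cospan $m,n$ and all $p_1,p_2,q_1,q_2$ with $mp_i=nq_i$ ($i=1,2$), there exist $a,b$ with $p_1a=p_2b$ and $q_1a=q_2b$. The slice category $\mathcal{C}/X$ has as objects the elements of $X\mathcal{C}$ and as morphisms the pairs $(\alpha,\gamma)$ with $\alpha\in X\mathcal{C}$, $r(\gamma)=s(\alpha)$; $(\alpha,\gamma)$ has range $\alpha$ and source $\alpha\gamma$, and $(\alpha,\gamma)(\alpha\gamma,\delta)=(\alpha,\gamma\delta)$. A functor $F:\mathcal{E}\to\mathcal{B}$ induces functors $F:\mathcal{E}/X\to\mathcal{B}/F(X)$. $F$ is locally split if for every object $X$ of $\mathcal{E}$ there is a functor $x:\mathcal{B}/F(X)\to\mathcal{E}/X$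 with $F\circ x=\mathrm{Id}$. A Kumjian-Pask fibration is a locally split discrete Conduché fibration $F:\mathcal{E}\to\mathcal{B}$ with $\mathcal{B}$ strongly right Ore. An infinite path to an object $X$ of $\mathcal{E}$ is a functor $x:\mathcal{B}/F(X)\to\mathcal{E}/X$ with $F\circ x=\mathrm{Id}_{\mathcal{B}/F(X)}$; $Z(X)$ is the set of these. For an object $a\in F(X)\mathcal{B}$ of $\mathcal{B}/F(X)$, $x(a)\in X\mathcal{E}$ denotes the image object. For a morphism $\mu:Y\to X$ of $\mathcal{E}$, $Z(\mu)=\{x\in Z(X):x(F(\mu))=\mu\}$. Domains of composites are the natural ones, e.g. the domain of $\mathrm{res}_\nu\circ\mathrm{res}_\mu$ is $\{x\in Z(\mu):\mathrm{res}_\mu(x)\in Z(\nu)\}$. *)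

theory Defs
  imports Main "HOL-Library.FuncSet"
begin

text \<open>Composition is anti-diagrammatic: \<open>\<alpha> \<cdot>\<^bsub>C\<^esub> \<beta>\<close> is meaningful when \<open>src C \<alpha> = rng C \<beta>\<close>, and then has
  source \<open>src C \<beta>\<close> and range \<open>rng C \<alpha>\<close>. All operations are unconstrained outside the carriers.\<close>

record ('o, 'm) cat =
  obj :: "'o set"
  mor :: "'m set"
  src :: "'m \<Rightarrow> 'o"
  rng :: "'m \<Rightarrow> 'o"
  ident :: "'o \<Rightarrow> 'm"
  cmp :: "'m \<Rightarrow> 'm \<Rightarrow> 'm" (infixl "\<cdot>\<index>" 70)

locale category =
  fixes C :: "('o, 'm) cat" (structure)
  assumes src_obj: "\<alpha> \<in> mor C \<Longrightarrow> src C \<alpha> \<in> obj C"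
    and rng_obj: "\<alpha> \<in> mor C \<Longrightarrow> rng C \<alpha> \<in> obj C"
    and ident_mor: "X \<in> obj C \<Longrightarrow> ident C X \<in> mor C"
    and src_ident: "X \<in> obj C \<Longrightarrow> src C (ident C X) = X"
    and rng_ident: "X \<in> obj C \<Longrightarrow> rng C (ident C X) = X"
    and cmp_mor: "\<lbrakk>\<alpha> \<in> mor C; \<beta> \<in> mor C; src C \<alpha> = rng C \<beta>\<rbrakk> \<Longrightarrow> \<alpha> \<cdot> \<beta> \<in> mor C"
    and src_cmp: "\<lbrakk>\<alpha> \<in> mor C; \<beta> \<in> mor C; src C \<alpha> = rng C \<beta>\<rbrakk> \<Longrightarrow> src C (\<alpha> \<cdot> \<beta>) = src C \<beta>"
    and rng_cmp: "\<lbrakk>\<alpha> \<in> mor C; \<beta> \<in> mor C; src C \<alpha> = rng C \<beta>\<rbrakk> \<Longrightarrow> rng C (\<alpha> \<cdot> \<beta>) = rng C \<alpha>"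
    and ident_cmp: "\<alpha> \<in> mor C \<Longrightarrow> ident C (rng C \<alpha>) \<cdot> \<alpha> = \<alpha>"
    and cmp_ident: "\<alpha> \<in> mor C \<Longrightarrow> \<alpha> \<cdot> ident C (src C \<alpha>) = \<alpha>"
    and cmp_assoc: "\<lbrakk>\<alpha> \<in> mor C; \<beta> \<in> mor C; \<gamma> \<in> mor C; src C \<alpha> = rng C \<beta>; src C \<beta> = rng C \<gamma>\<rbrakk>
      \<Longrightarrow> (\<alpha> \<cdot> \<beta>) \<cdot> \<gamma> = \<alpha> \<cdot> (\<beta> \<cdot> \<gamma>)"

text \<open>The set \<open>X\<C>\<close> of morphisms with codomain \<open>X\<close>.\<close>

definition mor_to :: "('o, 'm) cat \<Rightarrow> 'o \<Rightarrow> 'm set" where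
  "mor_to C X = {\<alpha> \<in> mor C. rng C \<alpha> = X}"

text \<open>Both components of a functor are required to be extensional (they take the value \<open>undefined\<close>
  outside the domain category), so that equality of functors is equality in HOL and sets of functors
  contain each functor exactly once.\<close>

record ('o1, 'm1, 'o2, 'm2) cat_fun =
  fobj :: "'o1 \<Rightarrow> 'o2"
  fmor :: "'m1 \<Rightarrow> 'm2"

locale category_functor = dom: category C + cod: category D
  for C :: "('o1, 'm1) cat" and D :: "('o2, 'm2) cat" +
  fixes F :: "('o1, 'm1, 'o2, 'm2) cat_fun"
  assumes fobj_ext: "fobj F \<in> obj C \<rightarrow>\<^sub>E obj D"
    and fmor_ext: "fmor F \<in> mor C \<rightarrow>\<^sub>E mor D"
    and src_fmor: "\<alpha> \<in> mor C \<Longrightarrow> src D (fmor F \<alpha>) = fobj F (src C \<alpha>)"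
    and rng_fmor: "\<alpha> \<in> mor C \<Longrightarrow> rng D (fmor F \<alpha>) = fobj F (rng C \<alpha>)"
    and fmor_ident: "X \<in> obj C \<Longrightarrow> fmor F (ident C X) = ident D (fobj F X)"
    and fmor_cmp: "\<lbrakk>\<alpha> \<in> mor C; \<beta> \<in> mor C; src C \<alpha> = rng C \<beta>\<rbrakk>
      \<Longrightarrow> fmor F (\<alpha> \<cdot>\<^bsub>C\<^esub> \<beta>) = fmor F \<alpha> \<cdot>\<^bsub>D\<^esub> fmor F \<beta>"

definition id_fun :: "('o, 'm) cat \<Rightarrow> ('o, 'm, 'o, 'm) cat_fun" where
  "id_fun C = \<lparr>fobj = (\<lambda>X\<in>obj C. X), fmor = (\<lambda>\<alpha>\<in>mor C. \<alpha>)\<rparr>"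

text \<open>\<open>comp_fun C G F\<close> is \<open>G \<circ> F\<close>, where \<open>C\<close> is the domain category of \<open>F\<close>.\<close>

definition comp_fun :: "('o1, 'm1) cat \<Rightarrow> ('o2, 'm2, 'o3, 'm3) cat_fun \<Rightarrow>
    ('o1, 'm1, 'o2, 'm2) cat_fun \<Rightarrow> ('o1, 'm1, 'o3, 'm3) cat_fun" where
  "comp_fun C G F =
    \<lparr>fobj = compose (obj C) (fobj G) (fobj F), fmor = compose (mor C) (fmor G) (fmor F)\<rparr>"

definition slice :: "('o, 'm) cat \<Rightarrow> 'o \<Rightarrow> ('m, 'm \<times> 'm) cat" where
  "slice C X =
    \<lparr>obj = mor_to C X,
     mor = {(\<alpha>, \<gamma>). \<alpha> \<in> mor_to C X \<and> \<gamma> \<in> mor C \<and> rng C \<gamma> = src C \<alpha>},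
     src = (\<lambda>(\<alpha>, \<gamma>). \<alpha> \<cdot>\<^bsub>C\<^esub> \<gamma>),
     rng = (\<lambda>(\<alpha>, \<gamma>). \<alpha>),
     ident = (\<lambda>\<alpha>. (\<alpha>, ident C (src C \<alpha>))),
     cmp = (\<lambda>(\<alpha>, \<gamma>) (\<beta>, \<delta>). (\<alpha>, \<gamma> \<cdot>\<^bsub>C\<^esub> \<delta>))\<rparr>"

definition slice_fun ::
    "('o1, 'm1) cat \<Rightarrow> ('o1, 'm1, 'o2, 'm2) cat_fun \<Rightarrow> 'o1 \<Rightarrow> ('m1, 'm1 \<times> 'm1, 'm2, 'm2 \<times> 'm2) cat_fun" where
  "slice_fun E F X =
    \<lparr>fobj = (\<lambda>\<alpha>\<in>obj (slice E X). fmor F \<alpha>),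
     fmor = (\<lambda>(\<alpha>, \<gamma>)\<in>mor (slice E X). (fmor F \<alpha>, fmor F \<gamma>))\<rparr>"

lemma category_slice:
  assumes "category C"
  shows "category (slice C X)"
proof -
  interpret category C by fact
  show ?thesis
    by unfold_locales
      (auto simp: slice_def mor_to_def src_obj rng_obj ident_mor src_ident rng_ident cmp_mor src_cmp
        rng_cmp cmp_ident cmp_assoc intro: ident_cmp simp flip: cmp_assoc, metis ident_cmp)
qed

lemma (in category_functor) category_functor_slice_fun:
  "category_functor (slice C X) (slice D (fobj F X)) (slice_fun C F X)"
proof -
  have 1: "fmor F \<alpha> \<in> mor D" if "\<alpha> \<in> mor C" for \<alpha>
    using fmor_ext that by auto
  interpret SC: category "slice C X" by (rule category_slice) unfold_locales
  interpret SD: category "slice D (fobj F X)" by (rule category_slice) unfold_locales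
  show ?thesis
    by unfold_locales
      (auto simp: slice_fun_def slice_def mor_to_def 1 src_fmor rng_fmor fmor_ident fmor_cmp
        dom.cmp_mor dom.src_cmp dom.rng_cmp dom.src_obj dom.ident_mor dom.rng_ident)
qed

definition discrete_conduche ::
    "('o1, 'm1) cat \<Rightarrow> ('o2, 'm2) cat \<Rightarrow> ('o1, 'm1, 'o2, 'm2) cat_fun \<Rightarrow> bool" where
  "discrete_conduche E B F \<longleftrightarrow> category_functor E B F \<and>
    (\<forall>\<phi>\<in>mor E. \<forall>\<rho>\<in>mor B. \<forall>\<kappa>\<in>mor B. src B \<rho> = rng B \<kappa> \<and> fmor F \<phi> = \<rho> \<cdot>\<^bsub>B\<^esub> \<kappa> \<longrightarrow>
      (\<exists>!(\<rho>', \<kappa>'). \<rho>' \<in> mor E \<and> \<kappa>' \<in> mor E \<and> src E \<rho>' = rng E \<kappa>' \<and> \<phi> = \<rho>' \<cdot>\<^bsub>E\<^esub> \<kappa>' \<and>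
        fmor F \<rho>' = \<rho> \<and> fmor F \<kappa>' = \<kappa>))"

text \<open>The two sides of a commuting square \<open>m p = n q\<close>: both composites are defined and agree
  (so \<open>p\<close> and \<open>q\<close> have the same source).\<close>

definition commuting_square :: "('o, 'm) cat \<Rightarrow> 'm \<Rightarrow> 'm \<Rightarrow> 'm \<Rightarrow> 'm \<Rightarrow> bool" where
  "commuting_square C m p n q \<longleftrightarrow> m \<in> mor C \<and> n \<in> mor C \<and> p \<in> mor C \<and> q \<in> mor C \<and>
    src C m = rng C p \<and> src C n = rng C q \<and> m \<cdot>\<^bsub>C\<^esub> p = n \<cdot>\<^bsub>C\<^esub> q"

definition right_ore :: "('o, 'm) cat \<Rightarrow> bool" where
  "right_ore C \<longleftrightarrow> category C \<and>
    (\<forall>m\<in>mor C. \<forall>n\<in>mor C. rng C m = rng C n \<longrightarrow> (\<exists>p q. commuting_square C m p n q))"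

definition strongly_right_ore :: "('o, 'm) cat \<Rightarrow> bool" where
  "strongly_right_ore C \<longleftrightarrow> right_ore C \<and>
    (\<forall>m\<in>mor C. \<forall>n\<in>mor C. rng C m = rng C n \<longrightarrow>
      (\<forall>p1 p2 q1 q2. commuting_square C m p1 n q1 \<and> commuting_square C m p2 n q2 \<longrightarrow>
        (\<exists>a b. commuting_square C p1 a p2 b \<and> commuting_square C q1 a q2 b)))"

text \<open>The set \<open>Z(X)\<close> of infinite paths to \<open>X\<close>.\<close>

definition infinite_paths ::
    "('o1, 'm1) cat \<Rightarrow> ('o2, 'm2) cat \<Rightarrow> ('o1, 'm1, 'o2, 'm2) cat_fun \<Rightarrow> 'o1 \<Rightarrow>
      ('m2, 'm2 \<times> 'm2, 'm1, 'm1 \<times> 'm1) cat_fun set" where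
  "infinite_paths E B F X =
    {x. category_functor (slice B (fobj F X)) (slice E X) x \<and>
        comp_fun (slice B (fobj F X)) (slice_fun E F X) x = id_fun (slice B (fobj F X))}"

definition locally_split ::
    "('o1, 'm1) cat \<Rightarrow> ('o2, 'm2) cat \<Rightarrow> ('o1, 'm1, 'o2, 'm2) cat_fun \<Rightarrow> bool" where
  "locally_split E B F \<longleftrightarrow> category_functor E B F \<and>
    (\<forall>X\<in>obj E. \<exists>x. category_functor (slice B (fobj F X)) (slice E X) x \<and>
      comp_fun (slice B (fobj F X)) (slice_fun E F X) x = id_fun (slice B (fobj F X)))"

definition kumjian_pask_fibration ::
    "('o1, 'm1) cat \<Rightarrow> ('o2, 'm2) cat \<Rightarrow> ('o1, 'm1, 'o2, 'm2) cat_fun \<Rightarrow> bool" where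
  "kumjian_pask_fibration E B F \<longleftrightarrow>
    discrete_conduche E B F \<and> locally_split E B F \<and> strongly_right_ore B"

definition cylinder ::
    "('o1, 'm1) cat \<Rightarrow> ('o2, 'm2) cat \<Rightarrow> ('o1, 'm1, 'o2, 'm2) cat_fun \<Rightarrow> 'm1 \<Rightarrow>
      ('m2, 'm2 \<times> 'm2, 'm1, 'm1 \<times> 'm1) cat_fun set" where
  "cylinder E B F \<mu> = {x \<in> infinite_paths E B F (rng E \<mu>). fobj x (fmor F \<mu>) = \<mu>}"

end

theory Submission
  imports Defs
begin

text \<open>
  By unique factorization, an infinite path to \<open>X\<close> is the same thing as a function \<open>f\<close> that lifts
  every \<open>a\<close> with range \<open>F(X)\<close> to a morphism \<open>f(a)\<close> with range \<open>X\<close> over \<open>a\<close>, such that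
  \<open>f(ac)\<close> is always \<open>f(a)\<close> composed with a morphism over \<open>c\<close>: the value of the path on a morphism \<open>(a,c)\<close> of the slice is forced,
  and the functor laws follow from uniqueness (\<open>infinite_path_eqI\<close>,
  \<open>coherent_lifting_imp_infinite_path\<close>). It therefore suffices to work with these coherent liftings.

  For \<open>\<mu> : Y \<rightarrow> X\<close>, say that a path \<open>y\<close> to \<open>X\<close> \<^emph>\<open>prolongs\<close> a path \<open>x\<close> to \<open>Y\<close> along \<open>\<mu>\<close> if
  \<open>y(F(\<mu>)a) = \<mu> x(a)\<close> for all \<open>a\<close>. This relation is a bijection between \<open>Z(Y)\<close> and \<open>Z(\<mu>)\<close>:

  \<^item> Each \<open>y\<close> in \<open>Z(\<mu>)\<close> prolongs exactly one \<open>x\<close>. As \<open>y(F(\<mu>)) = \<mu>\<close>, coherence makes \<open>\<mu>\<close> a left factor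
    of \<open>y(F(\<mu>)a)\<close>, and the complementary right factor over \<open>a\<close> is unique
    (\<open>prolongs_total_on_cylinder\<close>, \<open>prolongs_left_unique\<close>).
  \<^item> Each \<open>x\<close> has at most one prolongation. By the Ore condition every \<open>c\<close> with range \<open>F(X)\<close> fits into
    a square \<open>cp = F(\<mu>)q\<close>, and \<open>y(c)\<close> must be the left factor over \<open>c\<close> of \<open>y(cp) = \<mu> x(q)\<close>
    (\<open>prolongs_right_unique\<close>).
  \<^item> Each \<open>x\<close> has a prolongation. Read the previous item as a definition of \<open>y(c)\<close>; the strong Ore
    condition connects any two squares completing the cospan \<open>c, F(\<mu>)\<close>, so the left factor does not
    depend on the square (\<open>prolongs_total\<close>).

  With \<open>ind\<^sub>\<mu>\<close> and \<open>res\<^sub>\<mu>\<close> taken to be this relation read in its two directions, the remaining claims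
  express that prolongation is reflexive along identities, composes, and matches \<open>Z(\<nu>)\<close> with
  \<open>Z(\<mu>\<nu>)\<close>.
\<close>

section \<open>Unique factorization\<close>

locale conduche_fibration = category_functor E B F
  for E :: "('o1, 'm1) cat" and B :: "('o2, 'm2) cat" and F :: "('o1, 'm1, 'o2, 'm2) cat_fun" +
  assumes conduche: "discrete_conduche E B F"
begin

lemma fmor_mor [simp]: "\<alpha> \<in> mor E \<Longrightarrow> fmor F \<alpha> \<in> mor B"
  using fmor_ext by auto

lemma fobj_obj [simp]: "X \<in> obj E \<Longrightarrow> fobj F X \<in> obj B"
  using fobj_ext by auto

lemma factorization_exists:
  assumes "\<phi> \<in> mor E" "\<rho> \<in> mor B" "\<kappa> \<in> mor B" "src B \<rho> = rng B \<kappa>" "fmor F \<phi> = \<rho> \<cdot>\<^bsub>B\<^esub> \<kappa>"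
  obtains \<rho>' \<kappa>' where "\<rho>' \<in> mor E" "\<kappa>' \<in> mor E" "src E \<rho>' = rng E \<kappa>'" "\<phi> = \<rho>' \<cdot>\<^bsub>E\<^esub> \<kappa>'"
    "fmor F \<rho>' = \<rho>" "fmor F \<kappa>' = \<kappa>"
  using conduche assms unfolding discrete_conduche_def by blast

lemma factorization_unique:
  assumes "\<rho> \<in> mor E" "\<kappa> \<in> mor E" "src E \<rho> = rng E \<kappa>"
    and "\<rho>' \<in> mor E" "\<kappa>' \<in> mor E" "src E \<rho>' = rng E \<kappa>'"
    and "\<rho> \<cdot>\<^bsub>E\<^esub> \<kappa> = \<rho>' \<cdot>\<^bsub>E\<^esub> \<kappa>'" "fmor F \<rho> = fmor F \<rho>'" "fmor F \<kappa> = fmor F \<kappa>'"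
  shows "\<rho> = \<rho>'" "\<kappa> = \<kappa>'"
proof -
  let ?P = "\<lambda>(r, k). r \<in> mor E \<and> k \<in> mor E \<and> src E r = rng E k \<and> \<rho> \<cdot>\<^bsub>E\<^esub> \<kappa> = r \<cdot>\<^bsub>E\<^esub> k \<and>
    fmor F r = fmor F \<rho> \<and> fmor F k = fmor F \<kappa>"
  have "\<rho> \<cdot>\<^bsub>E\<^esub> \<kappa> \<in> mor E" "src B (fmor F \<rho>) = rng B (fmor F \<kappa>)"
    "fmor F (\<rho> \<cdot>\<^bsub>E\<^esub> \<kappa>) = fmor F \<rho> \<cdot>\<^bsub>B\<^esub> fmor F \<kappa>"
    using assms by (auto simp: dom.cmp_mor src_fmor rng_fmor fmor_cmp)
  then have "\<exists>!u. ?P u"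
    using conduche assms(1,2) unfolding discrete_conduche_def by simp
  moreover have "?P (\<rho>, \<kappa>)" "?P (\<rho>', \<kappa>')"
    using assms by auto
  ultimately have "(\<rho>, \<kappa>) = (\<rho>', \<kappa>')"
    by (blast dest: ex1E)
  then show "\<rho> = \<rho>'" "\<kappa> = \<kappa>'" by auto
qed

text \<open>A morphism \<open>\<phi>\<close> over an identity factors over \<open>id id\<close> both as \<open>\<phi> id\<close> and as \<open>id \<phi>\<close>, so these
  two factorizations coincide.\<close>

lemma morphism_over_identity:
  assumes "\<phi> \<in> mor E" "fmor F \<phi> = ident B (fobj F (rng E \<phi>))"
  shows "\<phi> = ident E (rng E \<phi>)"
proof (rule factorization_unique(1)[of \<phi> "ident E (src E \<phi>)" "ident E (rng E \<phi>)" \<phi>])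
  have "fobj F (src E \<phi>) = fobj F (rng E \<phi>)"
    using assms by (metis src_fmor cod.src_ident dom.rng_obj fobj_obj)
  then show "fmor F (ident E (src E \<phi>)) = fmor F \<phi>"
    using assms by (simp add: fmor_ident dom.src_obj)
qed (use assms in \<open>auto simp: fmor_ident dom.src_obj dom.rng_obj dom.ident_mor dom.src_ident
  dom.rng_ident dom.ident_cmp dom.cmp_ident\<close>)

section \<open>Infinite paths as coherent liftings\<close>

text \<open>The object part of an infinite path, described without mentioning slice categories.\<close>

definition coherent_lifting :: "'o1 \<Rightarrow> ('m2 \<Rightarrow> 'm1) \<Rightarrow> bool" where
  "coherent_lifting X f \<longleftrightarrow> f \<in> mor_to B (fobj F X) \<rightarrow>\<^sub>E mor_to E X \<and>
    (\<forall>a\<in>mor_to B (fobj F X). fmor F (f a) = a) \<and>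
    (\<forall>a\<in>mor_to B (fobj F X). \<forall>c\<in>mor B. rng B c = src B a \<longrightarrow>
      (\<exists>\<gamma>\<in>mor E. rng E \<gamma> = src E (f a) \<and> fmor F \<gamma> = c \<and> f (a \<cdot>\<^bsub>B\<^esub> c) = f a \<cdot>\<^bsub>E\<^esub> \<gamma>))"

lemma coherent_liftingD:
  assumes "coherent_lifting X f" "a \<in> mor_to B (fobj F X)"
  shows "f a \<in> mor E" "rng E (f a) = X" "fmor F (f a) = a" "fobj F (src E (f a)) = src B a"
proof -
  show 1: "f a \<in> mor E" "rng E (f a) = X" "fmor F (f a) = a"
    using assms by (auto simp: coherent_lifting_def mor_to_def PiE_iff)
  then show "fobj F (src E (f a)) = src B a"
    by (metis src_fmor)
qed

lemma coherent_lifting_cmp: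
  assumes "coherent_lifting X f" "a \<in> mor_to B (fobj F X)" "c \<in> mor B" "rng B c = src B a"
  obtains \<gamma> where "\<gamma> \<in> mor E" "rng E \<gamma> = src E (f a)" "fmor F \<gamma> = c"
    "f (a \<cdot>\<^bsub>B\<^esub> c) = f a \<cdot>\<^bsub>E\<^esub> \<gamma>"
  using assms unfolding coherent_lifting_def by blast

text \<open>Unique factorization turns coherence into a way to compute \<open>f(a)\<close>: any factorization of \<open>f(ac)\<close>
  over \<open>a\<close> and \<open>c\<close> exhibits it. Both the inclusion of cylinders and the uniqueness of prolongations
  rest on this.\<close>

lemma coherent_lifting_left_factor:
  assumes f: "coherent_lifting X f" "a \<in> mor_to B (fobj F X)" "c \<in> mor B" "rng B c = src B a"
    and "\<rho> \<in> mor E" "\<kappa> \<in> mor E" "src E \<rho> = rng E \<kappa>" "fmor F \<rho> = a" "fmor F \<kappa> = c"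
    and "f (a \<cdot>\<^bsub>B\<^esub> c) = \<rho> \<cdot>\<^bsub>E\<^esub> \<kappa>"
  shows "f a = \<rho>"
proof -
  obtain \<gamma> where "\<gamma> \<in> mor E" "rng E \<gamma> = src E (f a)" "fmor F \<gamma> = c" "f (a \<cdot>\<^bsub>B\<^esub> c) = f a \<cdot>\<^bsub>E\<^esub> \<gamma>"
    using coherent_lifting_cmp[OF f] by blast
  with assms coherent_liftingD[OF f(1,2)] show ?thesis
    using factorization_unique(1)[of "f a" \<gamma> \<rho> \<kappa>] by simp
qed

lemma coherent_lifting_ident:
  assumes "coherent_lifting X f" "X \<in> obj E"
  shows "f (ident B (fobj F X)) = ident E X"
proof -
  have "ident B (fobj F X) \<in> mor_to B (fobj F X)"
    using assms(2) by (simp add: mor_to_def cod.ident_mor cod.rng_ident)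
  from coherent_liftingD[OF assms(1) this] show ?thesis
    using morphism_over_identity by metis
qed

lemma infinite_path_fmor:
  assumes x: "x \<in> infinite_paths E B F X"
    and a: "a \<in> mor_to B (fobj F X)" and c: "c \<in> mor B" "rng B c = src B a"
  obtains \<gamma> where "\<gamma> \<in> mor E" "rng E \<gamma> = src E (fobj x a)" "fmor F \<gamma> = c"
    "fobj x (a \<cdot>\<^bsub>B\<^esub> c) = fobj x a \<cdot>\<^bsub>E\<^esub> \<gamma>" "fmor x (a, c) = (fobj x a, \<gamma>)"
proof -
  interpret x: category_functor "slice B (fobj F X)" "slice E X" x
    using x by (simp add: infinite_paths_def)
  have ac: "(a, c) \<in> mor (slice B (fobj F X))"
    using a c by (simp add: slice_def)
  obtain \<beta> \<gamma> where 1: "fmor x (a, c) = (\<beta>, \<gamma>)" by force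
  have 2: "(\<beta>, \<gamma>) \<in> mor (slice E X)"
    using x.fmor_ext ac 1 by (metis PiE_mem)
  have 3: "\<beta> = fobj x a" "\<beta> \<cdot>\<^bsub>E\<^esub> \<gamma> = fobj x (a \<cdot>\<^bsub>B\<^esub> c)"
    using x.rng_fmor[OF ac] x.src_fmor[OF ac] 1 by (auto simp: slice_def)
  have "fmor (comp_fun (slice B (fobj F X)) (slice_fun E F X) x) (a, c) = (a, c)"
    using x ac by (simp add: infinite_paths_def id_fun_def)
  then have "fmor F \<gamma> = c"
    using ac 1 2 by (simp add: comp_fun_def compose_def slice_fun_def)
  with 1 2 3 show ?thesis
    by (intro that[of \<gamma>]) (auto simp: slice_def)
qed

lemma coherent_lifting_fobj:
  assumes x: "x \<in> infinite_paths E B F X"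
  shows "coherent_lifting X (fobj x)"
proof -
  interpret x: category_functor "slice B (fobj F X)" "slice E X" x
    using x by (simp add: infinite_paths_def)
  have 1: "fobj x \<in> mor_to B (fobj F X) \<rightarrow>\<^sub>E mor_to E X"
    using x.fobj_ext by (simp add: slice_def)
  have "fmor F (fobj x a) = a" if a: "a \<in> mor_to B (fobj F X)" for a
  proof -
    have "fobj (comp_fun (slice B (fobj F X)) (slice_fun E F X) x) a = a"
      using x a by (simp add: infinite_paths_def id_fun_def slice_def)
    then show ?thesis
      using a PiE_mem[OF 1 a] by (simp add: comp_fun_def compose_def slice_fun_def slice_def)
  qed
  with 1 show ?thesis
    unfolding coherent_lifting_def by (metis infinite_path_fmor[OF x])
qed

text \<open>The value on a morphism \<open>(a,c)\<close> is determined by the values at \<open>a\<close> and at \<open>ac\<close>, because a right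
  factor over \<open>c\<close> is unique.\<close>

lemma infinite_path_eqI:
  assumes x: "x \<in> infinite_paths E B F X" and y: "y \<in> infinite_paths E B F X"
    and eq: "\<And>a. a \<in> mor_to B (fobj F X) \<Longrightarrow> fobj x a = fobj y a"
  shows "x = y"
proof -
  interpret x: category_functor "slice B (fobj F X)" "slice E X" x
    using x by (simp add: infinite_paths_def)
  interpret y: category_functor "slice B (fobj F X)" "slice E X" y
    using y by (simp add: infinite_paths_def)
  have "fobj x = fobj y"
    by (rule PiE_ext[OF x.fobj_ext y.fobj_ext]) (simp add: slice_def eq)
  moreover have "fmor x = fmor y"
  proof (rule PiE_ext[OF x.fmor_ext y.fmor_ext])
    fix u assume "u \<in> mor (slice B (fobj F X))"
    then obtain a c where u: "u = (a, c)" "a \<in> mor_to B (fobj F X)" "c \<in> mor B" "rng B c = src B a"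
      by (auto simp: slice_def)
    obtain \<gamma> where \<gamma>: "\<gamma> \<in> mor E" "rng E \<gamma> = src E (fobj x a)" "fmor F \<gamma> = c"
      "fobj x (a \<cdot>\<^bsub>B\<^esub> c) = fobj x a \<cdot>\<^bsub>E\<^esub> \<gamma>" "fmor x (a, c) = (fobj x a, \<gamma>)"
      using infinite_path_fmor[OF x u(2-4)] .
    obtain \<delta> where \<delta>: "\<delta> \<in> mor E" "rng E \<delta> = src E (fobj y a)" "fmor F \<delta> = c"
      "fobj y (a \<cdot>\<^bsub>B\<^esub> c) = fobj y a \<cdot>\<^bsub>E\<^esub> \<delta>" "fmor y (a, c) = (fobj y a, \<delta>)"
      using infinite_path_fmor[OF y u(2-4)] .
    have "\<gamma> = \<delta>"
      by (rule factorization_unique(2)[of "fobj x a" \<gamma> "fobj x a" \<delta>])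
        (use \<gamma> \<delta> coherent_liftingD[OF coherent_lifting_fobj[OF x] u(2)] \<open>fobj x = fobj y\<close> in auto)
    with u \<gamma> \<delta> \<open>fobj x = fobj y\<close> show "fmor x u = fmor y u" by simp
  qed
  ultimately show ?thesis by simp
qed

text \<open>The chosen right factors assemble to a functor since identities and composites of right
  factors are again right factors over the required morphisms.\<close>

lemma coherent_lifting_imp_infinite_path:
  assumes f: "coherent_lifting X f"
  obtains x where "x \<in> infinite_paths E B F X" "fobj x = f"
proof -
  let ?SB = "slice B (fobj F X)" and ?SE = "slice E X"
  let ?right = "\<lambda>a c \<gamma>. \<gamma> \<in> mor E \<and> rng E \<gamma> = src E (f a) \<and> fmor F \<gamma> = c \<and> f (a \<cdot>\<^bsub>B\<^esub> c) = f a \<cdot>\<^bsub>E\<^esub> \<gamma>"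
  define g where "g a c = (SOME \<gamma>. ?right a c \<gamma>)" for a c
  have g: "?right a c (g a c)"
    if "a \<in> mor_to B (fobj F X)" "c \<in> mor B" "rng B c = src B a" for a c
    unfolding g_def by (rule someI_ex) (use coherent_lifting_cmp[OF f that] in blast)
  have g_eq: "g a c = \<gamma>"
    if "a \<in> mor_to B (fobj F X)" "c \<in> mor B" "rng B c = src B a" "?right a c \<gamma>" for a c \<gamma>
    by (rule factorization_unique(2)[of "f a" _ "f a"])
      (use g[OF that(1-3)] that(4) coherent_liftingD[OF f that(1)] in auto)
  define x where "x = \<lparr>fobj = f, fmor = (\<lambda>(a, c)\<in>mor ?SB. (f a, g a c))\<rparr>"
  interpret SB: category ?SB by (rule category_slice) unfold_locales
  interpret SE: category ?SE by (rule category_slice) unfold_locales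
  have f_fun: "f \<in> mor_to B (fobj F X) \<rightarrow>\<^sub>E mor_to E X"
    using f by (simp add: coherent_lifting_def)
  have fmor_x: "fmor x (a, c) = (f a, g a c)"
    if "a \<in> mor_to B (fobj F X)" "c \<in> mor B" "rng B c = src B a" for a c
    using that by (simp add: x_def slice_def)
  have x_functor: "category_functor ?SB ?SE x"
  proof
    show "fobj x \<in> obj ?SB \<rightarrow>\<^sub>E obj ?SE"
      using f_fun by (simp add: x_def slice_def)
    show "fmor x \<in> mor ?SB \<rightarrow>\<^sub>E mor ?SE"
      using g PiE_mem[OF f_fun] by (auto simp: x_def slice_def)
    fix \<alpha> assume "\<alpha> \<in> mor ?SB"
    then obtain a c where \<alpha>: "\<alpha> = (a, c)" "a \<in> mor_to B (fobj F X)" "c \<in> mor B" "rng B c = src B a"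
      by (auto simp: slice_def)
    show "src ?SE (fmor x \<alpha>) = fobj x (src ?SB \<alpha>)" "rng ?SE (fmor x \<alpha>) = fobj x (rng ?SB \<alpha>)"
      using g[OF \<alpha>(2-4)] \<alpha> by (auto simp: fmor_x) (auto simp: slice_def x_def)
    fix \<beta> assume "\<beta> \<in> mor ?SB" and *: "src ?SB \<alpha> = rng ?SB \<beta>"
    then obtain d where \<beta>: "\<beta> = (a \<cdot>\<^bsub>B\<^esub> c, d)" "d \<in> mor B" "rng B d = src B (a \<cdot>\<^bsub>B\<^esub> c)"
      using \<alpha> by (auto simp: slice_def)
    have a: "a \<in> mor B" "rng B a = fobj F X" using \<alpha> by (auto simp: mor_to_def)
    have ac: "a \<cdot>\<^bsub>B\<^esub> c \<in> mor_to B (fobj F X)" and d: "rng B d = src B c"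
      using a \<alpha> \<beta> by (auto simp: mor_to_def cod.cmp_mor cod.rng_cmp cod.src_cmp)
    note g1 = g[OF \<alpha>(2-4)] and g2 = g[OF ac \<beta>(2,3)]
    have fa: "f a \<in> mor E" using coherent_liftingD[OF f \<alpha>(2)] by simp
    have cd: "c \<cdot>\<^bsub>B\<^esub> d \<in> mor B" "rng B (c \<cdot>\<^bsub>B\<^esub> d) = src B a"
      using \<alpha> \<beta> d by (auto simp: cod.cmp_mor cod.rng_cmp)
    have comp: "src E (g a c) = rng E (g (a \<cdot>\<^bsub>B\<^esub> c) d)"
      using g1 g2 fa by (simp add: dom.src_cmp)
    have "f (a \<cdot>\<^bsub>B\<^esub> (c \<cdot>\<^bsub>B\<^esub> d)) = f a \<cdot>\<^bsub>E\<^esub> (g a c \<cdot>\<^bsub>E\<^esub> g (a \<cdot>\<^bsub>B\<^esub> c) d)"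
      using g1 g2 fa comp a \<alpha> \<beta> d by (simp flip: cod.cmp_assoc dom.cmp_assoc)
    with g1 g2 comp have "g a (c \<cdot>\<^bsub>B\<^esub> d) = g a c \<cdot>\<^bsub>E\<^esub> g (a \<cdot>\<^bsub>B\<^esub> c) d"
      by (simp add: g_eq[OF \<alpha>(2) cd] dom.cmp_mor dom.rng_cmp fmor_cmp)
    then show "fmor x (\<alpha> \<cdot>\<^bsub>?SB\<^esub> \<beta>) = fmor x \<alpha> \<cdot>\<^bsub>?SE\<^esub> fmor x \<beta>"
      using fmor_x[OF \<alpha>(2) cd] fmor_x[OF ac \<beta>(2,3)] fmor_x[OF \<alpha>(2-4)] \<alpha>(1) \<beta>(1)
      by (simp add: slice_def)
  next
    fix a assume "a \<in> obj ?SB"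
    then have a: "a \<in> mor_to B (fobj F X)" "a \<in> mor B" by (auto simp: slice_def mor_to_def)
    note fa = coherent_liftingD[OF f a(1)]
    have i: "ident B (src B a) \<in> mor B" "rng B (ident B (src B a)) = src B a"
      using a by (auto simp: cod.ident_mor cod.src_obj cod.rng_ident)
    have "g a (ident B (src B a)) = ident E (src E (f a))"
      by (rule g_eq[OF a(1) i])
        (use fa a in \<open>auto simp: dom.ident_mor dom.src_obj dom.rng_ident fmor_ident dom.cmp_ident
          cod.cmp_ident\<close>)
    then show "fmor x (ident ?SB a) = ident ?SE (fobj x a)"
      using fmor_x[OF a(1) i] by (simp add: slice_def x_def)
  qed
  have "comp_fun ?SB (slice_fun E F X) x = id_fun ?SB"
  proof -
    have "fmor F (f a) = a" "f a \<in> mor_to E X" if "a \<in> mor_to B (fobj F X)" for a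
      using coherent_liftingD[OF f that] by (auto simp: mor_to_def)
    with g show ?thesis
      by (auto simp: comp_fun_def id_fun_def compose_def slice_fun_def slice_def x_def fun_eq_iff)
  qed
  with x_functor show ?thesis
    by (intro that[of x]) (auto simp: infinite_paths_def x_def)
qed

section \<open>Prolongation along a morphism\<close>

definition prolongs ::
    "'m1 \<Rightarrow> ('m2, 'm2 \<times> 'm2, 'm1, 'm1 \<times> 'm1) cat_fun \<Rightarrow> ('m2, 'm2 \<times> 'm2, 'm1, 'm1 \<times> 'm1) cat_fun \<Rightarrow> bool"
  where
  "prolongs \<mu> x y \<longleftrightarrow> x \<in> infinite_paths E B F (src E \<mu>) \<and> y \<in> infinite_paths E B F (rng E \<mu>) \<and>
    (\<forall>a\<in>mor_to B (fobj F (src E \<mu>)). fobj y (fmor F \<mu> \<cdot>\<^bsub>B\<^esub> a) = \<mu> \<cdot>\<^bsub>E\<^esub> fobj x a)"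

lemma cmp_mor_to:
  assumes "\<mu> \<in> mor E" "a \<in> mor_to B (fobj F (src E \<mu>))"
  shows "fmor F \<mu> \<cdot>\<^bsub>B\<^esub> a \<in> mor_to B (fobj F (rng E \<mu>))" "src B (fmor F \<mu> \<cdot>\<^bsub>B\<^esub> a) = src B a"
    "fmor F \<mu> \<in> mor_to B (fobj F (rng E \<mu>))" "a \<in> mor B" "rng B a = src B (fmor F \<mu>)"
  using assms by (auto simp: mor_to_def cod.cmp_mor cod.rng_cmp cod.src_cmp src_fmor rng_fmor)

text \<open>Take \<open>a\<close> to be the identity of \<open>F(s(\<mu>))\<close>: a path sends an identity to an identity, because
  nothing else lies over it.\<close>

lemma prolongs_imp_cylinder:
  assumes \<mu>: "\<mu> \<in> mor E" and "prolongs \<mu> x y"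
  shows "y \<in> cylinder E B F \<mu>"
proof -
  let ?i = "ident B (fobj F (src E \<mu>))"
  have x: "x \<in> infinite_paths E B F (src E \<mu>)" and y: "y \<in> infinite_paths E B F (rng E \<mu>)"
    using assms by (auto simp: prolongs_def)
  have "?i \<in> mor_to B (fobj F (src E \<mu>))"
    using \<mu> by (simp add: mor_to_def cod.ident_mor cod.rng_ident dom.src_obj)
  then have "fobj y (fmor F \<mu> \<cdot>\<^bsub>B\<^esub> ?i) = \<mu> \<cdot>\<^bsub>E\<^esub> fobj x ?i"
    using assms by (simp add: prolongs_def)
  moreover have "fmor F \<mu> \<cdot>\<^bsub>B\<^esub> ?i = fmor F \<mu>"
    using \<mu> by (metis src_fmor cod.cmp_ident fmor_mor)
  moreover have "fobj x ?i = ident E (src E \<mu>)"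
    using coherent_lifting_ident[OF coherent_lifting_fobj[OF x]] \<mu> by (simp add: dom.src_obj)
  ultimately show ?thesis
    using \<mu> y by (simp add: cylinder_def dom.cmp_ident)
qed

lemma prolongs_left_unique:
  assumes \<mu>: "\<mu> \<in> mor E" and "prolongs \<mu> x y" "prolongs \<mu> x' y"
  shows "x = x'"
proof (rule infinite_path_eqI)
  show x: "x \<in> infinite_paths E B F (src E \<mu>)" and x': "x' \<in> infinite_paths E B F (src E \<mu>)"
    using assms by (auto simp: prolongs_def)
  fix a assume a: "a \<in> mor_to B (fobj F (src E \<mu>))"
  have eq: "\<mu> \<cdot>\<^bsub>E\<^esub> fobj x a = \<mu> \<cdot>\<^bsub>E\<^esub> fobj x' a"
    using assms a by (auto simp: prolongs_def)
  show "fobj x a = fobj x' a"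
    by (rule factorization_unique(2)[of \<mu> _ \<mu>])
      (use \<mu> eq coherent_liftingD[OF coherent_lifting_fobj[OF x] a]
        coherent_liftingD[OF coherent_lifting_fobj[OF x'] a] in auto)
qed

text \<open>The value of \<open>x\<close> at \<open>a\<close> is the right factor of \<open>y(F(\<mu>)a)\<close> complementary to \<open>\<mu>\<close>. Coherence of
  \<open>x\<close> then follows from that of \<open>y\<close> by cancelling \<open>\<mu>\<close>, which is legitimate between morphisms with
  the same image under \<open>F\<close>.\<close>

lemma prolongs_total_on_cylinder:
  assumes \<mu>: "\<mu> \<in> mor E" and y: "y \<in> cylinder E B F \<mu>"
  obtains x where "prolongs \<mu> x y"
proof -
  let ?Y = "src E \<mu>"
  have y': "y \<in> infinite_paths E B F (rng E \<mu>)" and y\<mu>: "fobj y (fmor F \<mu>) = \<mu>"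
    using y by (auto simp: cylinder_def)
  note ly = coherent_lifting_fobj[OF y']
  let ?rest = "\<lambda>a \<gamma>. \<gamma> \<in> mor E \<and> rng E \<gamma> = ?Y \<and> fmor F \<gamma> = a \<and> fobj y (fmor F \<mu> \<cdot>\<^bsub>B\<^esub> a) = \<mu> \<cdot>\<^bsub>E\<^esub> \<gamma>"
  define f where "f = (\<lambda>a\<in>mor_to B (fobj F ?Y). SOME \<gamma>. ?rest a \<gamma>)"
  have f: "?rest a (f a)" if a: "a \<in> mor_to B (fobj F ?Y)" for a
  proof -
    have "\<exists>\<gamma>. ?rest a \<gamma>"
      using coherent_lifting_cmp[OF ly cmp_mor_to(3-5)[OF \<mu> a]] y\<mu> by metis
    from someI_ex[OF this] show ?thesis using a by (simp add: f_def)
  qed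
  have "coherent_lifting ?Y f"
    unfolding coherent_lifting_def
  proof (intro conjI ballI impI)
    show "f \<in> mor_to B (fobj F ?Y) \<rightarrow>\<^sub>E mor_to E ?Y"
      using f by (auto simp: mor_to_def f_def)
    fix a assume a: "a \<in> mor_to B (fobj F ?Y)"
    show "fmor F (f a) = a" using f[OF a] by simp
    fix c assume c: "c \<in> mor B" "rng B c = src B a"
    note \<mu>a = cmp_mor_to[OF \<mu> a]
    have ac: "a \<cdot>\<^bsub>B\<^esub> c \<in> mor_to B (fobj F ?Y)"
      using a c by (auto simp: mor_to_def cod.cmp_mor cod.rng_cmp)
    obtain \<delta> where \<delta>: "\<delta> \<in> mor E" "rng E \<delta> = src E (fobj y (fmor F \<mu> \<cdot>\<^bsub>B\<^esub> a))" "fmor F \<delta> = c"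
      "fobj y ((fmor F \<mu> \<cdot>\<^bsub>B\<^esub> a) \<cdot>\<^bsub>B\<^esub> c) = fobj y (fmor F \<mu> \<cdot>\<^bsub>B\<^esub> a) \<cdot>\<^bsub>E\<^esub> \<delta>"
      using coherent_lifting_cmp[OF ly \<mu>a(1) c(1)] c(2) \<mu>a(2) by metis
    have \<delta>_rng: "rng E \<delta> = src E (f a)"
      using \<delta>(2) f[OF a] \<mu> by (simp add: dom.src_cmp)
    have "\<mu> \<cdot>\<^bsub>E\<^esub> f (a \<cdot>\<^bsub>B\<^esub> c) = fobj y (fmor F \<mu> \<cdot>\<^bsub>B\<^esub> (a \<cdot>\<^bsub>B\<^esub> c))"
      using f[OF ac] by simp
    also have "\<dots> = (\<mu> \<cdot>\<^bsub>E\<^esub> f a) \<cdot>\<^bsub>E\<^esub> \<delta>"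
      using \<delta>(4) f[OF a] \<mu>a c \<mu> by (simp add: cod.cmp_assoc)
    also have "\<dots> = \<mu> \<cdot>\<^bsub>E\<^esub> (f a \<cdot>\<^bsub>E\<^esub> \<delta>)"
      using f[OF a] \<delta> \<delta>_rng \<mu> by (simp add: dom.cmp_assoc)
    finally have eq: "\<mu> \<cdot>\<^bsub>E\<^esub> f (a \<cdot>\<^bsub>B\<^esub> c) = \<mu> \<cdot>\<^bsub>E\<^esub> (f a \<cdot>\<^bsub>E\<^esub> \<delta>)" .
    have "f (a \<cdot>\<^bsub>B\<^esub> c) = f a \<cdot>\<^bsub>E\<^esub> \<delta>"
      by (rule factorization_unique(2)[of \<mu> _ \<mu>])
        (use eq f[OF a] f[OF ac] \<delta> \<delta>_rng \<mu> in \<open>auto simp: dom.cmp_mor dom.rng_cmp fmor_cmp\<close>)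
    with \<delta> \<delta>_rng show "\<exists>\<gamma>\<in>mor E. rng E \<gamma> = src E (f a) \<and> fmor F \<gamma> = c \<and> f (a \<cdot>\<^bsub>B\<^esub> c) = f a \<cdot>\<^bsub>E\<^esub> \<gamma>"
      by auto
  qed
  then obtain x where "x \<in> infinite_paths E B F ?Y" "fobj x = f"
    by (rule coherent_lifting_imp_infinite_path)
  with f y' show ?thesis
    by (intro that[of x]) (auto simp: prolongs_def)
qed

lemma prolongs_ident:
  assumes "X \<in> obj E" and x: "x \<in> infinite_paths E B F X"
  shows "prolongs (ident E X) x x"
proof -
  have "ident B (fobj F X) \<cdot>\<^bsub>B\<^esub> a = a \<and> ident E X \<cdot>\<^bsub>E\<^esub> fobj x a = fobj x a"
    if a: "a \<in> mor_to B (fobj F X)" for a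
  proof
    show "ident B (fobj F X) \<cdot>\<^bsub>B\<^esub> a = a"
      using a cod.ident_cmp[of a] by (auto simp: mor_to_def)
    show "ident E X \<cdot>\<^bsub>E\<^esub> fobj x a = fobj x a"
      using coherent_liftingD[OF coherent_lifting_fobj[OF x] a] dom.ident_cmp by metis
  qed
  with assms show ?thesis
    by (simp add: prolongs_def dom.src_ident dom.rng_ident fmor_ident)
qed

lemma prolongs_cmp:
  assumes m: "\<mu> \<in> mor E" "\<nu> \<in> mor E" "src E \<mu> = rng E \<nu>"
    and p: "prolongs \<nu> x y" "prolongs \<mu> y z"
  shows "prolongs (\<mu> \<cdot>\<^bsub>E\<^esub> \<nu>) x z"
proof -
  have x: "x \<in> infinite_paths E B F (src E \<nu>)" using p by (simp add: prolongs_def)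
  have "fobj z ((fmor F \<mu> \<cdot>\<^bsub>B\<^esub> fmor F \<nu>) \<cdot>\<^bsub>B\<^esub> a) = (\<mu> \<cdot>\<^bsub>E\<^esub> \<nu>) \<cdot>\<^bsub>E\<^esub> fobj x a"
    if a: "a \<in> mor_to B (fobj F (src E \<nu>))" for a
  proof -
    note \<nu>a = cmp_mor_to[OF m(2) a]
    have "(fmor F \<mu> \<cdot>\<^bsub>B\<^esub> fmor F \<nu>) \<cdot>\<^bsub>B\<^esub> a = fmor F \<mu> \<cdot>\<^bsub>B\<^esub> (fmor F \<nu> \<cdot>\<^bsub>B\<^esub> a)"
      using m \<nu>a by (simp add: cod.cmp_assoc src_fmor rng_fmor)
    moreover have "fobj z (fmor F \<mu> \<cdot>\<^bsub>B\<^esub> (fmor F \<nu> \<cdot>\<^bsub>B\<^esub> a)) = \<mu> \<cdot>\<^bsub>E\<^esub> (\<nu> \<cdot>\<^bsub>E\<^esub> fobj x a)"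
      using p a \<nu>a(1) m(3) by (simp add: prolongs_def)
    ultimately show ?thesis
      using m coherent_liftingD[OF coherent_lifting_fobj[OF x] a] by (simp add: dom.cmp_assoc)
  qed
  with m p show ?thesis
    by (simp add: prolongs_def dom.src_cmp dom.rng_cmp fmor_cmp)
qed

text \<open>Both memberships concern the equation \<open>y(F(\<mu>)F(\<nu>)) = \<mu> x(F(\<nu>))\<close>: the left side is \<open>\<mu>\<nu>\<close> exactly
  if \<open>x(F(\<nu>)) = \<nu>\<close>, since \<open>\<mu>\<close> cancels between morphisms over \<open>F(\<nu>)\<close>.\<close>

lemma prolongs_cylinder_iff:
  assumes m: "\<mu> \<in> mor E" "\<nu> \<in> mor E" "src E \<mu> = rng E \<nu>" and p: "prolongs \<mu> x y"
  shows "x \<in> cylinder E B F \<nu> \<longleftrightarrow> y \<in> cylinder E B F (\<mu> \<cdot>\<^bsub>E\<^esub> \<nu>)"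
proof -
  have x: "x \<in> infinite_paths E B F (rng E \<nu>)" and y: "y \<in> infinite_paths E B F (rng E \<mu>)"
    using p m by (auto simp: prolongs_def)
  have \<nu>: "fmor F \<nu> \<in> mor_to B (fobj F (rng E \<nu>))"
    using m by (simp add: mor_to_def rng_fmor)
  have eq: "fobj y (fmor F (\<mu> \<cdot>\<^bsub>E\<^esub> \<nu>)) = \<mu> \<cdot>\<^bsub>E\<^esub> fobj x (fmor F \<nu>)"
    using p \<nu> m by (simp add: prolongs_def fmor_cmp)
  have "fobj x (fmor F \<nu>) = \<nu>" if "\<mu> \<cdot>\<^bsub>E\<^esub> fobj x (fmor F \<nu>) = \<mu> \<cdot>\<^bsub>E\<^esub> \<nu>"
    by (rule factorization_unique(2)[of \<mu> _ \<mu>])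
      (use that m coherent_liftingD[OF coherent_lifting_fobj[OF x] \<nu>] in auto)
  with x y eq m show ?thesis
    by (auto simp: cylinder_def dom.rng_cmp)
qed

lemma cylinder_cmp_subset:
  assumes m: "\<mu> \<in> mor E" "\<nu> \<in> mor E" "src E \<mu> = rng E \<nu>"
  shows "cylinder E B F (\<mu> \<cdot>\<^bsub>E\<^esub> \<nu>) \<subseteq> cylinder E B F \<mu>"
proof
  fix y assume "y \<in> cylinder E B F (\<mu> \<cdot>\<^bsub>E\<^esub> \<nu>)"
  then have y: "y \<in> infinite_paths E B F (rng E \<mu>)" "fobj y (fmor F \<mu> \<cdot>\<^bsub>B\<^esub> fmor F \<nu>) = \<mu> \<cdot>\<^bsub>E\<^esub> \<nu>"
    using m by (auto simp: cylinder_def dom.rng_cmp fmor_cmp)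
  have "fobj y (fmor F \<mu>) = \<mu>"
    by (rule coherent_lifting_left_factor[OF coherent_lifting_fobj[OF y(1)], of _ "fmor F \<nu>" _ \<nu>])
      (use m y(2) in \<open>auto simp: mor_to_def src_fmor rng_fmor\<close>)
  with y(1) show "y \<in> cylinder E B F \<mu>" by (simp add: cylinder_def)
qed

lemma cylinder_ident:
  assumes X: "X \<in> obj E"
  shows "cylinder E B F (ident E X) = infinite_paths E B F X"
  using coherent_lifting_ident[OF coherent_lifting_fobj X] X
  by (auto simp: cylinder_def dom.rng_ident fmor_ident)

end

section \<open>Existence and uniqueness of prolongations over an Ore base\<close>

locale ore_conduche_fibration = conduche_fibration E B F
  for E :: "('o1, 'm1) cat" and B :: "('o2, 'm2) cat" and F :: "('o1, 'm1, 'o2, 'm2) cat_fun" +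
  assumes ore: "strongly_right_ore B"
begin

lemma ore_square:
  assumes "\<mu> \<in> mor E" "c \<in> mor_to B (fobj F (rng E \<mu>))"
  obtains p q where "commuting_square B c p (fmor F \<mu>) q"
proof -
  have "c \<in> mor B" "fmor F \<mu> \<in> mor B" "rng B c = rng B (fmor F \<mu>)"
    using assms by (auto simp: mor_to_def rng_fmor)
  then show ?thesis
    using ore that unfolding strongly_right_ore_def right_ore_def by blast
qed

lemma square_mor_to:
  assumes "\<mu> \<in> mor E" "commuting_square B c p (fmor F \<mu>) q"
  shows "q \<in> mor_to B (fobj F (src E \<mu>))" "p \<in> mor B" "rng B p = src B c" "c \<in> mor B"
    "q \<in> mor B" "c \<cdot>\<^bsub>B\<^esub> p = fmor F \<mu> \<cdot>\<^bsub>B\<^esub> q"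
  using assms by (auto simp: commuting_square_def mor_to_def src_fmor)

text \<open>The morphism \<open>\<rho>\<close> is the value at \<open>c\<close> that the square \<open>cp = F(\<mu>)q\<close> imposes on a prolongation
  along \<open>\<mu>\<close> of a path with object part \<open>f\<close>.\<close>

definition forced_value :: "'m1 \<Rightarrow> ('m2 \<Rightarrow> 'm1) \<Rightarrow> 'm2 \<Rightarrow> 'm2 \<Rightarrow> 'm2 \<Rightarrow> 'm1 \<Rightarrow> bool" where
  "forced_value \<mu> f c p q \<rho> \<longleftrightarrow> \<rho> \<in> mor E \<and> fmor F \<rho> = c \<and>
    (\<exists>\<kappa>\<in>mor E. src E \<rho> = rng E \<kappa> \<and> fmor F \<kappa> = p \<and> \<mu> \<cdot>\<^bsub>E\<^esub> f q = \<rho> \<cdot>\<^bsub>E\<^esub> \<kappa>)"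

lemma prolongs_forced_value:
  assumes \<mu>: "\<mu> \<in> mor E" and p: "prolongs \<mu> x y"
    and c: "c \<in> mor_to B (fobj F (rng E \<mu>))" and sq: "commuting_square B c p (fmor F \<mu>) q"
    and "forced_value \<mu> (fobj x) c p q \<rho>"
  shows "fobj y c = \<rho>"
proof -
  note s = square_mor_to[OF \<mu> sq]
  have y: "y \<in> infinite_paths E B F (rng E \<mu>)" using p by (simp add: prolongs_def)
  have "fobj y (c \<cdot>\<^bsub>B\<^esub> p) = \<mu> \<cdot>\<^bsub>E\<^esub> fobj x q"
    using p s by (simp add: prolongs_def)
  then show ?thesis
    using assms(5) coherent_lifting_left_factor[OF coherent_lifting_fobj[OF y] c s(2,3)]
    by (auto simp: forced_value_def)
qed

lemma forced_value_exists:
  assumes \<mu>: "\<mu> \<in> mor E" and f: "coherent_lifting (src E \<mu>) f"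
    and sq: "commuting_square B c p (fmor F \<mu>) q"
  obtains \<rho> where "forced_value \<mu> f c p q \<rho>"
proof -
  note s = square_mor_to[OF \<mu> sq]
  note fq = coherent_liftingD[OF f s(1)]
  have "\<mu> \<cdot>\<^bsub>E\<^esub> f q \<in> mor E" "fmor F (\<mu> \<cdot>\<^bsub>E\<^esub> f q) = c \<cdot>\<^bsub>B\<^esub> p"
    using \<mu> fq s by (auto simp: dom.cmp_mor fmor_cmp)
  then show ?thesis
    using factorization_exists[of "\<mu> \<cdot>\<^bsub>E\<^esub> f q" c p] s that unfolding forced_value_def by metis
qed

text \<open>Extending a square by a common right factor \<open>b\<close> does not change the value it forces, since
  \<open>f(qb)\<close> has \<open>f(q)\<close> as a left factor.\<close>

lemma forced_value_extend_square:
  assumes \<mu>: "\<mu> \<in> mor E" and f: "coherent_lifting (src E \<mu>) f"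
    and sq: "commuting_square B c p (fmor F \<mu>) q" and v: "forced_value \<mu> f c p q \<rho>"
    and b: "b \<in> mor B" "rng B b = src B p" "rng B b = src B q"
  shows "forced_value \<mu> f c (p \<cdot>\<^bsub>B\<^esub> b) (q \<cdot>\<^bsub>B\<^esub> b) \<rho>"
proof -
  note s = square_mor_to[OF \<mu> sq]
  note fq = coherent_liftingD[OF f s(1)]
  obtain \<kappa> where \<kappa>: "\<kappa> \<in> mor E" "src E \<rho> = rng E \<kappa>" "fmor F \<kappa> = p" "\<mu> \<cdot>\<^bsub>E\<^esub> f q = \<rho> \<cdot>\<^bsub>E\<^esub> \<kappa>"
    and \<rho>: "\<rho> \<in> mor E" "fmor F \<rho> = c"
    using v by (auto simp: forced_value_def)
  obtain \<gamma> where \<gamma>: "\<gamma> \<in> mor E" "rng E \<gamma> = src E (f q)" "fmor F \<gamma> = b" "f (q \<cdot>\<^bsub>B\<^esub> b) = f q \<cdot>\<^bsub>E\<^esub> \<gamma>"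
    using coherent_lifting_cmp[OF f s(1) b(1,3)] .
  have "src E \<kappa> = src E (f q)"
    using \<kappa> \<rho> \<mu> fq by (metis dom.src_cmp)
  moreover have "\<mu> \<cdot>\<^bsub>E\<^esub> f (q \<cdot>\<^bsub>B\<^esub> b) = (\<mu> \<cdot>\<^bsub>E\<^esub> f q) \<cdot>\<^bsub>E\<^esub> \<gamma>"
    using \<gamma> \<mu> fq by (simp add: dom.cmp_assoc)
  ultimately show ?thesis
    unfolding forced_value_def using \<rho> \<kappa> \<gamma>
    by (auto simp: dom.cmp_mor dom.rng_cmp fmor_cmp dom.cmp_assoc intro!: bexI[of _ "\<kappa> \<cdot>\<^bsub>E\<^esub> \<gamma>"])
qed

lemma forced_value_unique:
  assumes \<mu>: "\<mu> \<in> mor E" and f: "coherent_lifting (src E \<mu>) f"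
    and sq: "commuting_square B c p (fmor F \<mu>) q" "commuting_square B c p' (fmor F \<mu>) q'"
    and v: "forced_value \<mu> f c p q \<rho>" "forced_value \<mu> f c p' q' \<rho>'"
  shows "\<rho> = \<rho>'"
proof -
  note s = square_mor_to[OF \<mu> sq(1)]
  have "rng B c = rng B (c \<cdot>\<^bsub>B\<^esub> p)"
    using s(2-4) by (simp add: cod.rng_cmp)
  also have "\<dots> = rng B (fmor F \<mu>)"
    unfolding s(6) using s(1,5) \<mu> by (simp add: cod.rng_cmp mor_to_def src_fmor)
  finally have "rng B c = rng B (fmor F \<mu>)" .
  with s(4) \<mu> obtain b b' where "commuting_square B p b p' b'" "commuting_square B q b q' b'"
    using ore sq unfolding strongly_right_ore_def by (meson fmor_mor)
  then have b: "b \<in> mor B" "rng B b = src B p" "rng B b = src B q"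
    and b': "b' \<in> mor B" "rng B b' = src B p'" "rng B b' = src B q'"
    and eq: "p \<cdot>\<^bsub>B\<^esub> b = p' \<cdot>\<^bsub>B\<^esub> b'" "q \<cdot>\<^bsub>B\<^esub> b = q' \<cdot>\<^bsub>B\<^esub> b'"
    by (auto simp: commuting_square_def)
  have "forced_value \<mu> f c (p \<cdot>\<^bsub>B\<^esub> b) (q \<cdot>\<^bsub>B\<^esub> b) \<rho>" "forced_value \<mu> f c (p \<cdot>\<^bsub>B\<^esub> b) (q \<cdot>\<^bsub>B\<^esub> b) \<rho>'"
    using forced_value_extend_square[OF \<mu> f sq(1) v(1) b]
      forced_value_extend_square[OF \<mu> f sq(2) v(2) b'] eq by auto
  then show ?thesis
    unfolding forced_value_def using factorization_unique(1) by metis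
qed

lemma prolongs_right_unique:
  assumes \<mu>: "\<mu> \<in> mor E" and p: "prolongs \<mu> x y" "prolongs \<mu> x y'"
  shows "y = y'"
proof (rule infinite_path_eqI)
  show "y \<in> infinite_paths E B F (rng E \<mu>)" "y' \<in> infinite_paths E B F (rng E \<mu>)"
    using p by (auto simp: prolongs_def)
  have f: "coherent_lifting (src E \<mu>) (fobj x)"
    using p by (intro coherent_lifting_fobj) (simp add: prolongs_def)
  fix c assume c: "c \<in> mor_to B (fobj F (rng E \<mu>))"
  obtain q r where sq: "commuting_square B c q (fmor F \<mu>) r"
    using ore_square[OF \<mu> c] .
  obtain \<rho> where "forced_value \<mu> (fobj x) c q r \<rho>"
    using forced_value_exists[OF \<mu> f sq] .
  then show "fobj y c = fobj y' c"
    using prolongs_forced_value[OF \<mu> p(1) c sq] prolongs_forced_value[OF \<mu> p(2) c sq] by simp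
qed

text \<open>Since the value at \<open>c\<close> may be read off any square, each property of the prolongation can be
  checked with a square adapted to it.\<close>

lemma prolongs_total:
  assumes \<mu>: "\<mu> \<in> mor E" and x: "x \<in> infinite_paths E B F (src E \<mu>)"
  obtains y where "prolongs \<mu> x y"
proof -
  let ?X = "rng E \<mu>"
  note f = coherent_lifting_fobj[OF x]
  let ?val = "\<lambda>c \<rho>. \<exists>p q. commuting_square B c p (fmor F \<mu>) q \<and> forced_value \<mu> (fobj x) c p q \<rho>"
  define h where "h = (\<lambda>c\<in>mor_to B (fobj F ?X). SOME \<rho>. ?val c \<rho>)"
  have h: "?val c (h c)" if c: "c \<in> mor_to B (fobj F ?X)" for c
  proof -
    have "\<exists>\<rho>. ?val c \<rho>"
      using ore_square[OF \<mu> c] forced_value_exists[OF \<mu> f] by metis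
    from someI_ex[OF this] show ?thesis using c by (simp add: h_def)
  qed
  have h_eq: "h c = \<rho>"
    if "c \<in> mor_to B (fobj F ?X)" "commuting_square B c p (fmor F \<mu>) q"
      "forced_value \<mu> (fobj x) c p q \<rho>" for c p q \<rho>
    using h[OF that(1)] that(2,3) forced_value_unique[OF \<mu> f] by metis
  have h_over: "h c \<in> mor E" "rng E (h c) = ?X" "fmor F (h c) = c"
    if c: "c \<in> mor_to B (fobj F ?X)" for c
  proof -
    obtain p q where sq: "commuting_square B c p (fmor F \<mu>) q"
      and v: "forced_value \<mu> (fobj x) c p q (h c)"
      using h[OF c] by blast
    show "h c \<in> mor E" "fmor F (h c) = c" using v by (auto simp: forced_value_def)
    have "rng E (\<mu> \<cdot>\<^bsub>E\<^esub> fobj x q) = ?X"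
      using \<mu> coherent_liftingD[OF f square_mor_to(1)[OF \<mu> sq]] by (simp add: dom.rng_cmp)
    then show "rng E (h c) = ?X" using v by (auto simp: forced_value_def dom.rng_cmp)
  qed
  have "coherent_lifting ?X h"
    unfolding coherent_lifting_def
  proof (intro conjI ballI impI)
    show "h \<in> mor_to B (fobj F ?X) \<rightarrow>\<^sub>E mor_to E ?X"
      using h_over by (auto simp: mor_to_def h_def)
    fix c assume c: "c \<in> mor_to B (fobj F ?X)"
    show "fmor F (h c) = c" using h_over[OF c] by simp
    fix d assume d: "d \<in> mor B" "rng B d = src B c"
    have c': "c \<in> mor B" using c by (simp add: mor_to_def)
    have cd: "c \<cdot>\<^bsub>B\<^esub> d \<in> mor_to B (fobj F ?X)"
      using c d by (auto simp: mor_to_def cod.cmp_mor cod.rng_cmp)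
    obtain p q where sq: "commuting_square B (c \<cdot>\<^bsub>B\<^esub> d) p (fmor F \<mu>) q"
      and v: "forced_value \<mu> (fobj x) (c \<cdot>\<^bsub>B\<^esub> d) p q (h (c \<cdot>\<^bsub>B\<^esub> d))"
      using h[OF cd] by blast
    note s = square_mor_to[OF \<mu> sq]
    have dp: "rng B p = src B d" using s(3) c' d by (simp add: cod.src_cmp)
    \<comment> \<open>A square over \<open>cd\<close> is also one over \<open>c\<close>, so both values can be read off the same morphism.\<close>
    have sq': "commuting_square B c (d \<cdot>\<^bsub>B\<^esub> p) (fmor F \<mu>) q"
      using sq c' d dp s
      by (auto simp: commuting_square_def cod.cmp_mor cod.rng_cmp cod.cmp_assoc)
    obtain \<kappa> where \<kappa>: "\<kappa> \<in> mor E" "src E (h (c \<cdot>\<^bsub>B\<^esub> d)) = rng E \<kappa>" "fmor F \<kappa> = p"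
      "\<mu> \<cdot>\<^bsub>E\<^esub> fobj x q = h (c \<cdot>\<^bsub>B\<^esub> d) \<cdot>\<^bsub>E\<^esub> \<kappa>"
      using v by (auto simp: forced_value_def)
    obtain \<rho> \<gamma> where \<rho>: "\<rho> \<in> mor E" "\<gamma> \<in> mor E" "src E \<rho> = rng E \<gamma>" "h (c \<cdot>\<^bsub>B\<^esub> d) = \<rho> \<cdot>\<^bsub>E\<^esub> \<gamma>"
      "fmor F \<rho> = c" "fmor F \<gamma> = d"
      using factorization_exists[of "h (c \<cdot>\<^bsub>B\<^esub> d)" c d] h_over[OF cd] c' d by metis
    have "src E \<gamma> = rng E \<kappa>" using \<kappa>(2) \<rho> by (simp add: dom.src_cmp)
    then have "forced_value \<mu> (fobj x) c (d \<cdot>\<^bsub>B\<^esub> p) q \<rho>"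
      unfolding forced_value_def using \<rho> \<kappa>
      by (auto simp: dom.cmp_mor dom.rng_cmp fmor_cmp dom.cmp_assoc intro!: bexI[of _ "\<gamma> \<cdot>\<^bsub>E\<^esub> \<kappa>"])
    then have "h c = \<rho>" by (rule h_eq[OF c sq'])
    with \<rho> show "\<exists>\<gamma>\<in>mor E. rng E \<gamma> = src E (h c) \<and> fmor F \<gamma> = d \<and> h (c \<cdot>\<^bsub>B\<^esub> d) = h c \<cdot>\<^bsub>E\<^esub> \<gamma>"
      by auto
  qed
  then obtain y where y: "y \<in> infinite_paths E B F ?X" "fobj y = h"
    by (rule coherent_lifting_imp_infinite_path)
  have "h (fmor F \<mu> \<cdot>\<^bsub>B\<^esub> a) = \<mu> \<cdot>\<^bsub>E\<^esub> fobj x a" if a: "a \<in> mor_to B (fobj F (src E \<mu>))" for a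
  proof (rule h_eq)
    note \<mu>a = cmp_mor_to[OF \<mu> a]
    note xa = coherent_liftingD[OF f a]
    show "fmor F \<mu> \<cdot>\<^bsub>B\<^esub> a \<in> mor_to B (fobj F ?X)" by (rule \<mu>a)
    have \<mu>a': "fmor F \<mu> \<cdot>\<^bsub>B\<^esub> a \<in> mor B" using \<mu>a(1) by (simp add: mor_to_def)
    \<comment> \<open>With the trivial square on \<open>F(\<mu>)a\<close>, the forced value is the whole morphism \<open>\<mu> x(a)\<close>.\<close>
    show "commuting_square B (fmor F \<mu> \<cdot>\<^bsub>B\<^esub> a) (ident B (src B a)) (fmor F \<mu>) a"
      using \<mu> \<mu>a \<mu>a' cod.cmp_ident[OF \<mu>a']
      by (simp add: commuting_square_def cod.ident_mor cod.src_obj cod.rng_ident)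
    have m: "\<mu> \<cdot>\<^bsub>E\<^esub> fobj x a \<in> mor E" "src E (\<mu> \<cdot>\<^bsub>E\<^esub> fobj x a) = src E (fobj x a)"
      using \<mu> xa by (auto simp: dom.cmp_mor dom.src_cmp)
    show "forced_value \<mu> (fobj x) (fmor F \<mu> \<cdot>\<^bsub>B\<^esub> a) (ident B (src B a)) a (\<mu> \<cdot>\<^bsub>E\<^esub> fobj x a)"
      unfolding forced_value_def using \<mu> xa m dom.cmp_ident[OF m(1)]
      by (auto simp: fmor_cmp fmor_ident dom.ident_mor dom.src_obj dom.rng_ident
        intro!: bexI[of _ "ident E (src E (fobj x a))"])
  qed
  with x y show ?thesis
    by (intro that[of y]) (simp add: prolongs_def)
qed

section \<open>Induction and restriction of paths\<close>

definition ind_path ::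
    "'m1 \<Rightarrow> ('m2, 'm2 \<times> 'm2, 'm1, 'm1 \<times> 'm1) cat_fun \<Rightarrow> ('m2, 'm2 \<times> 'm2, 'm1, 'm1 \<times> 'm1) cat_fun" where
  "ind_path \<mu> x = (THE y. prolongs \<mu> x y)"

definition res_path ::
    "'m1 \<Rightarrow> ('m2, 'm2 \<times> 'm2, 'm1, 'm1 \<times> 'm1) cat_fun \<Rightarrow> ('m2, 'm2 \<times> 'm2, 'm1, 'm1 \<times> 'm1) cat_fun" where
  "res_path \<mu> y = (THE x. prolongs \<mu> x y)"

lemma prolongs_imp_ind_path: "\<mu> \<in> mor E \<Longrightarrow> prolongs \<mu> x y \<Longrightarrow> ind_path \<mu> x = y"
  unfolding ind_path_def using prolongs_right_unique by blast

lemma prolongs_imp_res_path: "\<mu> \<in> mor E \<Longrightarrow> prolongs \<mu> x y \<Longrightarrow> res_path \<mu> y = x"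
  unfolding res_path_def using prolongs_left_unique by blast

lemma prolongs_ind_path:
  "\<mu> \<in> mor E \<Longrightarrow> x \<in> infinite_paths E B F (src E \<mu>) \<Longrightarrow> prolongs \<mu> x (ind_path \<mu> x)"
  using prolongs_total prolongs_imp_ind_path by metis

lemma prolongs_res_path:
  "\<mu> \<in> mor E \<Longrightarrow> y \<in> cylinder E B F \<mu> \<Longrightarrow> prolongs \<mu> (res_path \<mu> y) y"
  using prolongs_total_on_cylinder prolongs_imp_res_path by metis

lemma ind_res_path: "\<mu> \<in> mor E \<Longrightarrow> y \<in> cylinder E B F \<mu> \<Longrightarrow> ind_path \<mu> (res_path \<mu> y) = y"
  by (intro prolongs_imp_ind_path prolongs_res_path)

lemma res_ind_path:
  "\<mu> \<in> mor E \<Longrightarrow> x \<in> infinite_paths E B F (src E \<mu>) \<Longrightarrow> res_path \<mu> (ind_path \<mu> x) = x"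
  by (intro prolongs_imp_res_path prolongs_ind_path)

lemma ind_path_cylinder:
  "\<mu> \<in> mor E \<Longrightarrow> x \<in> infinite_paths E B F (src E \<mu>) \<Longrightarrow> ind_path \<mu> x \<in> cylinder E B F \<mu>"
  using prolongs_imp_cylinder prolongs_ind_path by blast

lemma res_path_infinite_path:
  "\<mu> \<in> mor E \<Longrightarrow> y \<in> cylinder E B F \<mu> \<Longrightarrow> res_path \<mu> y \<in> infinite_paths E B F (src E \<mu>)"
  using prolongs_res_path by (auto simp: prolongs_def)

lemma res_path_cylinder_iff:
  assumes "\<mu> \<in> mor E" "\<nu> \<in> mor E" "src E \<mu> = rng E \<nu>" "y \<in> cylinder E B F \<mu>"
  shows "res_path \<mu> y \<in> cylinder E B F \<nu> \<longleftrightarrow> y \<in> cylinder E B F (\<mu> \<cdot>\<^bsub>E\<^esub> \<nu>)"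
  using assms by (intro prolongs_cylinder_iff prolongs_res_path)

lemma ind_path_cylinder_iff:
  assumes "\<mu> \<in> mor E" "\<nu> \<in> mor E" "src E \<mu> = rng E \<nu>" "x \<in> infinite_paths E B F (src E \<mu>)"
  shows "ind_path \<mu> x \<in> cylinder E B F (\<mu> \<cdot>\<^bsub>E\<^esub> \<nu>) \<longleftrightarrow> x \<in> cylinder E B F \<nu>"
  using prolongs_cylinder_iff[OF assms(1-3) prolongs_ind_path[OF assms(1,4)]] by simp

lemma cylinder_subset: "cylinder E B F \<mu> \<subseteq> infinite_paths E B F (rng E \<mu>)"
  by (auto simp: cylinder_def)

lemma ind_path_image_cylinder:
  assumes m: "\<mu> \<in> mor E" "\<nu> \<in> mor E" "src E \<mu> = rng E \<nu>"
  shows "ind_path \<mu> ` cylinder E B F \<nu> = cylinder E B F (\<mu> \<cdot>\<^bsub>E\<^esub> \<nu>)"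
proof (intro equalityI subsetI)
  fix y assume "y \<in> ind_path \<mu> ` cylinder E B F \<nu>"
  then obtain x where "y = ind_path \<mu> x" "x \<in> cylinder E B F \<nu>" by blast
  moreover from this have "x \<in> infinite_paths E B F (src E \<mu>)"
    using cylinder_subset m(3) by auto
  ultimately show "y \<in> cylinder E B F (\<mu> \<cdot>\<^bsub>E\<^esub> \<nu>)"
    using ind_path_cylinder_iff[OF m] by simp
next
  fix y assume y: "y \<in> cylinder E B F (\<mu> \<cdot>\<^bsub>E\<^esub> \<nu>)"
  then have y': "y \<in> cylinder E B F \<mu>" using cylinder_cmp_subset[OF m] by blast
  then show "y \<in> ind_path \<mu> ` cylinder E B F \<nu>"
    using y ind_res_path[OF m(1) y'] res_path_cylinder_iff[OF m y'] by (metis imageI)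
qed

lemma res_path_image_cylinder:
  assumes m: "\<mu> \<in> mor E" "\<nu> \<in> mor E" "src E \<mu> = rng E \<nu>"
  shows "res_path \<mu> ` cylinder E B F (\<mu> \<cdot>\<^bsub>E\<^esub> \<nu>) = cylinder E B F \<nu>"
proof -
  have "res_path \<mu> (ind_path \<mu> x) = x" if "x \<in> cylinder E B F \<nu>" for x
    by (rule res_ind_path) (use that cylinder_subset m in auto)
  then show ?thesis
    by (simp add: image_image flip: ind_path_image_cylinder[OF m])
qed

lemma ind_path_cmp:
  assumes m: "\<mu> \<in> mor E" "\<nu> \<in> mor E" "src E \<mu> = rng E \<nu>" and x: "x \<in> infinite_paths E B F (src E \<nu>)"
  shows "ind_path \<mu> (ind_path \<nu> x) = ind_path (\<mu> \<cdot>\<^bsub>E\<^esub> \<nu>) x"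
proof -
  have 1: "prolongs \<nu> x (ind_path \<nu> x)" by (rule prolongs_ind_path[OF m(2) x])
  then have "ind_path \<nu> x \<in> infinite_paths E B F (src E \<mu>)" using m by (simp add: prolongs_def)
  from prolongs_cmp[OF m 1 prolongs_ind_path[OF m(1) this]] show ?thesis
    using prolongs_imp_ind_path dom.cmp_mor[OF m] by metis
qed

lemma res_path_cmp:
  assumes m: "\<mu> \<in> mor E" "\<nu> \<in> mor E" "src E \<mu> = rng E \<nu>" and y: "y \<in> cylinder E B F (\<mu> \<cdot>\<^bsub>E\<^esub> \<nu>)"
  shows "res_path \<nu> (res_path \<mu> y) = res_path (\<mu> \<cdot>\<^bsub>E\<^esub> \<nu>) y"
proof -
  have y': "y \<in> cylinder E B F \<mu>" using y cylinder_cmp_subset[OF m] by blast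
  then have "res_path \<mu> y \<in> cylinder E B F \<nu>" using res_path_cylinder_iff[OF m] y by blast
  from prolongs_cmp[OF m prolongs_res_path[OF m(2) this] prolongs_res_path[OF m(1) y']]
  show ?thesis
    using prolongs_imp_res_path dom.cmp_mor[OF m] by metis
qed

end

theorem proposition3p17:
  fixes E :: "('o1, 'm1) cat" and B :: "('o2, 'm2) cat" and F :: "('o1, 'm1, 'o2, 'm2) cat_fun"
  assumes "kumjian_pask_fibration E B F"
  shows "\<exists>(ind :: 'm1 \<Rightarrow> ('m2, 'm2 \<times> 'm2, 'm1, 'm1 \<times> 'm1) cat_fun \<Rightarrow> ('m2, 'm2 \<times> 'm2, 'm1, 'm1 \<times> 'm1) cat_fun)
      (res :: 'm1 \<Rightarrow> ('m2, 'm2 \<times> 'm2, 'm1, 'm1 \<times> 'm1) cat_fun \<Rightarrow> ('m2, 'm2 \<times> 'm2, 'm1, 'm1 \<times> 'm1) cat_fun).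
    (\<forall>\<mu>\<in>mor E.
      bij_betw (ind \<mu>) (infinite_paths E B F (src E \<mu>)) (cylinder E B F \<mu>) \<and>
      bij_betw (res \<mu>) (cylinder E B F \<mu>) (infinite_paths E B F (src E \<mu>))) \<and>
    (\<forall>\<mu>\<in>mor E. \<forall>x\<in>infinite_paths E B F (src E \<mu>). \<forall>a\<in>mor_to B (fobj F (src E \<mu>)).
      fobj (ind \<mu> x) (fmor F \<mu> \<cdot>\<^bsub>B\<^esub> a) = \<mu> \<cdot>\<^bsub>E\<^esub> fobj x a) \<and>
    (\<forall>\<mu>\<in>mor E.
      (\<forall>x\<in>cylinder E B F \<mu>. ind \<mu> (res \<mu> x) = x) \<and>
      (\<forall>x\<in>infinite_paths E B F (src E \<mu>). res \<mu> (ind \<mu> x) = x)) \<and>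
    (\<forall>X\<in>obj E.
      cylinder E B F (ident E X) = infinite_paths E B F X \<and>
      (\<forall>x\<in>infinite_paths E B F X. ind (ident E X) x = x \<and> res (ident E X) x = x)) \<and>
    (\<forall>\<mu>\<in>mor E. \<forall>\<nu>\<in>mor E. src E \<mu> = rng E \<nu> \<longrightarrow>
      res \<mu> ` cylinder E B F (\<mu> \<cdot>\<^bsub>E\<^esub> \<nu>) = cylinder E B F \<nu> \<and>
      ind \<mu> ` cylinder E B F \<nu> = cylinder E B F (\<mu> \<cdot>\<^bsub>E\<^esub> \<nu>)) \<and>
    (\<forall>\<mu>\<in>mor E. \<forall>\<nu>\<in>mor E. src E \<mu> = rng E \<nu> \<longrightarrow>
      {x \<in> cylinder E B F \<mu>. res \<mu> x \<in> cylinder E B F \<nu>} = cylinder E B F (\<mu> \<cdot>\<^bsub>E\<^esub> \<nu>) \<and>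
      (\<forall>x\<in>cylinder E B F (\<mu> \<cdot>\<^bsub>E\<^esub> \<nu>). res \<nu> (res \<mu> x) = res (\<mu> \<cdot>\<^bsub>E\<^esub> \<nu>) x)) \<and>
    (\<forall>\<mu>\<in>mor E. \<forall>\<nu>\<in>mor E. src E \<mu> = rng E \<nu> \<longrightarrow>
      {x \<in> infinite_paths E B F (src E \<nu>). ind \<nu> x \<in> infinite_paths E B F (src E \<mu>)}
        = infinite_paths E B F (src E \<nu>) \<and>
      (\<forall>x\<in>infinite_paths E B F (src E \<nu>). ind \<mu> (ind \<nu> x) = ind (\<mu> \<cdot>\<^bsub>E\<^esub> \<nu>) x))"
proof -
  interpret ore_conduche_fibration E B F
    using assms unfolding kumjian_pask_fibration_def discrete_conduche_def
    by (intro ore_conduche_fibration.intro conduche_fibration.intro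
      conduche_fibration_axioms.intro ore_conduche_fibration_axioms.intro)
      (auto simp: discrete_conduche_def)
  show ?thesis
  proof (rule exI[of _ ind_path], rule exI[of _ res_path], intro conjI ballI impI)
    fix \<mu> assume \<mu>: "\<mu> \<in> mor E"
    show "bij_betw (ind_path \<mu>) (infinite_paths E B F (src E \<mu>)) (cylinder E B F \<mu>)"
      using \<mu> by (intro bij_betwI[of _ _ _ "res_path \<mu>"])
        (auto simp: ind_path_cylinder res_path_infinite_path ind_res_path res_ind_path)
    show "bij_betw (res_path \<mu>) (cylinder E B F \<mu>) (infinite_paths E B F (src E \<mu>))"
      using \<mu> by (intro bij_betwI[of _ _ _ "ind_path \<mu>"])
        (auto simp: ind_path_cylinder res_path_infinite_path ind_res_path res_ind_path)
    show "ind_path \<mu> (res_path \<mu> x) = x" if "x \<in> cylinder E B F \<mu>" for x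
      using ind_res_path[OF \<mu> that] .
    show "res_path \<mu> (ind_path \<mu> x) = x" if "x \<in> infinite_paths E B F (src E \<mu>)" for x
      using res_ind_path[OF \<mu> that] .
    show "fobj (ind_path \<mu> x) (fmor F \<mu> \<cdot>\<^bsub>B\<^esub> a) = \<mu> \<cdot>\<^bsub>E\<^esub> fobj x a"
      if "x \<in> infinite_paths E B F (src E \<mu>)" "a \<in> mor_to B (fobj F (src E \<mu>))" for x a
      using prolongs_ind_path[OF \<mu> that(1)] that(2) by (simp add: prolongs_def)
    fix \<nu> assume \<nu>: "\<nu> \<in> mor E" "src E \<mu> = rng E \<nu>"
    note m = \<mu> \<nu>
    show "res_path \<mu> ` cylinder E B F (\<mu> \<cdot>\<^bsub>E\<^esub> \<nu>) = cylinder E B F \<nu>"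
      by (rule res_path_image_cylinder[OF m])
    show "ind_path \<mu> ` cylinder E B F \<nu> = cylinder E B F (\<mu> \<cdot>\<^bsub>E\<^esub> \<nu>)"
      by (rule ind_path_image_cylinder[OF m])
    show "{x \<in> cylinder E B F \<mu>. res_path \<mu> x \<in> cylinder E B F \<nu>} = cylinder E B F (\<mu> \<cdot>\<^bsub>E\<^esub> \<nu>)"
      using res_path_cylinder_iff[OF m] cylinder_cmp_subset[OF m] by blast
    show "res_path \<nu> (res_path \<mu> x) = res_path (\<mu> \<cdot>\<^bsub>E\<^esub> \<nu>) x"
      if "x \<in> cylinder E B F (\<mu> \<cdot>\<^bsub>E\<^esub> \<nu>)" for x
      using res_path_cmp[OF m that] .
    show "{x \<in> infinite_paths E B F (src E \<nu>). ind_path \<nu> x \<in> infinite_paths E B F (src E \<mu>)}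
        = infinite_paths E B F (src E \<nu>)"
      using ind_path_cylinder[OF \<nu>(1)] cylinder_subset \<nu>(2) by fastforce
    show "ind_path \<mu> (ind_path \<nu> x) = ind_path (\<mu> \<cdot>\<^bsub>E\<^esub> \<nu>) x"
      if "x \<in> infinite_paths E B F (src E \<nu>)" for x
      using ind_path_cmp[OF m that] .
  next
    fix X assume X: "X \<in> obj E"
    show "cylinder E B F (ident E X) = infinite_paths E B F X"
      by (rule cylinder_ident[OF X])
    fix x assume x: "x \<in> infinite_paths E B F X"
    show "ind_path (ident E X) x = x" "res_path (ident E X) x = x"
      using prolongs_ident[OF X x] prolongs_imp_ind_path prolongs_imp_res_path dom.ident_mor[OF X]
      by auto
  qed
qed

end
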